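(* Let $X$ be a geodesic metric measure space with doubling measure $\mu$. Then every strongly harmonic function in $X$ that is bounded from below is constant.
   Context: Standing assumptions: $\mu$ is Borel regular, $0<\mu(B)<\infty$ for every ball $B$, and $X$ is proper (closed bounded sets are compact). $\mu$ is doubling if there is $C_\mu>0$ with $\mu(B(x,2r))\le C_\mu\mu(B(x,r))$ for all balls. $X$ is geodesic if any two points are joined by a curve of length equal to their distance. $A\Subset X$ means that $A$ has compact closure. A locally integrable $f:X\to\mathbb{R}$ is strongly harmonic in $X$ if $f(x)=\frac{1}{\mu(B(x,r))}\int_{B(x,r)}f\,d\mu$ for all $x\in X$, $r>0$ with $B(x,r)\Subset X$. *)

theory Defs
  imports "HOL-Analysis.Analysis"
begin

(* The Borel regular outer measure is represented by its restriction to its measurable sets. The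
   sigma-algebra may be larger than the Borel one (typically its completion), so functions that
   are measurable with respect to the measure without being Borel are covered. *)
definition borel_regular :: "'a::topological_space measure \<Rightarrow> bool" where
  "borel_regular M \<longleftrightarrow>
     space M = UNIV \<and> sets borel \<subseteq> sets M \<and>
     (\<forall>A\<in>sets M. \<exists>B\<in>sets borel. A \<subseteq> B \<and> emeasure M B = emeasure M A)"

definition metric_measure_space :: "'a::metric_space measure \<Rightarrow> bool" where
  "metric_measure_space M \<longleftrightarrow>
     borel_regular M \<and>
     (\<forall>x. \<forall>r>0. 0 < emeasure M (ball x r) \<and> emeasure M (ball x r) < \<infinity>) \<and>
     (\<forall>S::'a set. closed S \<and> bounded S \<longrightarrow> compact S)"

definition doubling_measure :: "'a::metric_space measure \<Rightarrow> bool" where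
  "doubling_measure M \<longleftrightarrow>
     (\<exists>C::real. C > 0 \<and>
        (\<forall>x. \<forall>r>0. emeasure M (ball x (2 * r)) \<le> ennreal C * emeasure M (ball x r)))"

(* Supremum of the lengths of inscribed polygons; the lists run over the finite nondecreasing
   sequences of parameters. *)
definition curve_length :: "(real \<Rightarrow> 'a::metric_space) \<Rightarrow> ennreal" where
  "curve_length g =
     (SUP ts\<in>{ts. sorted ts \<and> set ts \<subseteq> {0..1}}.
        \<Sum>i<length ts - 1. ennreal (dist (g (ts ! i)) (g (ts ! Suc i))))"

definition geodesic_space :: "'a::metric_space itself \<Rightarrow> bool" where
  "geodesic_space _ \<longleftrightarrow>
     (\<forall>x y::'a. \<exists>g. path g \<and> pathstart g = x \<and> pathfinish g = y \<and>
        curve_length g = ennreal (dist x y))"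

definition locally_integrable :: "'a::metric_space measure \<Rightarrow> ('a \<Rightarrow> real) \<Rightarrow> bool" where
  "locally_integrable M f \<longleftrightarrow> (\<forall>x. \<exists>r>0. set_integrable M (ball x r) f)"

definition strongly_harmonic :: "'a::metric_space measure \<Rightarrow> ('a \<Rightarrow> real) \<Rightarrow> bool" where
  "strongly_harmonic M f \<longleftrightarrow>
     locally_integrable M f \<and>
     (\<forall>x. \<forall>r>0. compact (closure (ball x r)) \<longrightarrow>
        f x = (1 / measure M (ball x r)) * (LINT y:ball x r|M. f y))"

end

theory Submission
  imports Defs "HOL-Real_Asymp.Real_Asymp"
begin

text \<open>Let \<open>f\<close> be strongly harmonic with lower bound \<open>m\<close>, and let \<open>d = dist x y\<close>. Integrating
  \<open>f - m\<close> over the nested balls \<open>B(y, R) \<subseteq> B(x, R + d) \<subseteq> B(y, R + 2d)\<close> gives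
  \<open>f y - m \<le> (f x - m) \<mu>(B(y, R + 2d)) / \<mu>(B(y, R))\<close>. The measure of \<open>B(y, R)\<close> grows at most
  polynomially in \<open>R\<close> by doubling, so this quotient of measures cannot stay above \<open>1 + \<epsilon>\<close> for all
  \<open>R\<close>: that would force exponential growth. Hence \<open>f y \<le> f x\<close>, and equality follows by symmetry.\<close>

text \<open>If every ratio \<open>a (Suc n) / a n\<close> exceeded \<open>1 + e\<close>, then
  \<open>a (2 ^ k)\<close> would be at least \<open>(1 + e) ^ (2 ^ k - 1) * a 1\<close>, whereas
  iterating the doubling bound along powers of two gives at most \<open>C ^ k * a 1\<close>. For
  large \<open>k\<close> these contradict each other.\<close>

lemma doubling_sequence_ratio:
  fixes a :: "nat \<Rightarrow> real"
  assumes pos: "\<And>n. n \<ge> 1 \<Longrightarrow> a n > 0"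
    and dbl: "\<And>n. n \<ge> 1 \<Longrightarrow> a (2 * n) \<le> C * a n"
    and "C > 0" "e > 0"
  shows "\<exists>n\<ge>1. a (Suc n) \<le> (1 + e) * a n"
proof (rule ccontr)
  assume "\<not> ?thesis"
  then have step: "(1 + e) * a n \<le> a (Suc n)" if "n \<ge> 1" for n
    using that by (meson linorder_le_cases)
  have lower: "(1 + e) ^ n * a 1 \<le> a (Suc n)" for n
  proof (induction n)
    case (Suc n)
    have "(1 + e) ^ Suc n * a 1 = (1 + e) * ((1 + e) ^ n * a 1)"
      by (simp add: mult.assoc)
    also have "\<dots> \<le> (1 + e) * a (Suc n)"
      using Suc \<open>e > 0\<close> by (intro mult_left_mono) auto
    also have "\<dots> \<le> a (Suc (Suc n))"
      by (rule step) simp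
    finally show ?case .
  qed simp
  have upper: "a (2 ^ k) \<le> C ^ k * a 1" for k
  proof (induction k)
    case (Suc k)
    have "a (2 ^ Suc k) \<le> C * a (2 ^ k)"
      using dbl[of "2 ^ k"] by simp
    also have "\<dots> \<le> C * (C ^ k * a 1)"
      using Suc \<open>C > 0\<close> by (intro mult_left_mono) auto
    finally show ?case by (simp add: mult.assoc)
  qed simp
  \<comment> \<open>Writing \<open>C\<close> below a power of \<open>1 + e\<close> reduces the
    comparison of the two bounds to that of the exponents \<open>N * k\<close> and
    \<open>2 ^ k - 1\<close>.\<close>
  obtain N where N: "C < (1 + e) ^ N"
    using real_arch_pow[of "1 + e" C] \<open>e > 0\<close> by auto
  have "\<forall>\<^sub>F k in sequentially. real N * real k + 2 \<le> 2 ^ k"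
    by real_asymp
  \<comment> \<open>The condition \<open>k \<ge> 1\<close> keeps the inequality strict when
    \<open>k\<close>-th powers are taken below.\<close>
  then have "\<forall>\<^sub>F k in sequentially. real N * real k + 2 \<le> 2 ^ k \<and> k \<ge> 1"
    using eventually_ge_at_top[of 1] by (rule eventually_conj)
  then obtain k where k: "real N * real k + 2 \<le> 2 ^ k" "k \<ge> 1"
    by (auto simp: eventually_sequentially)
  from k(1) have "real (N * k + 2) \<le> real (2 ^ k)" by simp
  then have Nk: "N * k \<le> 2 ^ k - 1" by linarith
  have "C ^ k < ((1 + e) ^ N) ^ k"
    using N \<open>C > 0\<close> k(2) by (intro power_strict_mono) auto
  also have "\<dots> \<le> (1 + e) ^ (2 ^ k - 1)"
    unfolding power_mult[symmetric] using \<open>e > 0\<close> Nk by (intro power_increasing) auto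
  finally have "C ^ k * a 1 < (1 + e) ^ (2 ^ k - 1) * a 1"
    using pos[of 1] by simp
  also have "\<dots> \<le> a (2 ^ k)"
    using lower[of "2 ^ k - 1"] by simp
  finally show False using upper[of k] by simp
qed

text \<open>Compactness of \<open>K\<close> leaves finitely many balls of integrability that cover
  \<open>K\<close>; \<open>f\<close> is integrable on their union, hence on its measurable subset
  \<open>A\<close>.\<close>

lemma locally_integrable_set_integrable:
  fixes f :: "'a::metric_space \<Rightarrow> real"
  assumes "locally_integrable M f" "sets borel \<subseteq> sets M"
    and "compact K" "A \<subseteq> K" "A \<in> sets M"
  shows "set_integrable M A f"
proof -
  obtain r where r: "\<And>x. r x > 0" "\<And>x. set_integrable M (ball x (r x)) f"
    using assms(1) unfolding locally_integrable_def by metis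
  have "K \<subseteq> (\<Union>x\<in>K. ball x (r x))"
    using r(1) by force
  then obtain D where D: "finite D" "K \<subseteq> (\<Union>x\<in>D. ball x (r x))"
    using compactE_image[OF \<open>compact K\<close>, of K "\<lambda>x. ball x (r x)"] by (metis open_ball)
  have "ball x (r x) \<in> sets M" for x
    using assms(2) by auto
  then have "set_integrable M (\<Union>x\<in>D. ball x (r x)) f"
    using D(1) r(2) by (intro set_integrable_UN) auto
  then show ?thesis
    by (rule set_integrable_subset) (use D(2) assms in auto)
qed

lemma strongly_harmonic_le:
  fixes M :: "'a::metric_space measure" and f :: "'a \<Rightarrow> real"
  assumes mms: "metric_measure_space M" and dbl: "doubling_measure M"
    and harm: "strongly_harmonic M f" and m: "\<And>z. m \<le> f z"
  shows "f y \<le> f x"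
proof (cases "x = y")
  case False
  define d where "d = dist x y"
  have "d > 0" using False by (simp add: d_def)
  have borel: "sets borel \<subseteq> sets M"
    using mms by (auto simp: metric_measure_space_def borel_regular_def)
  have ball_sets [measurable]: "ball z r \<in> sets M" for z r
    using borel by auto
  have finite_ball: "emeasure M (ball z r) \<noteq> \<infinity>" if "r > 0" for z r
    using mms that by (auto simp: metric_measure_space_def less_top)
  have pos: "measure M (ball z r) > 0" if "r > 0" for z r
    using mms that by (auto simp: metric_measure_space_def measure_def enn2real_positive_iff)
  \<comment> \<open>Properness makes the mean value property available for balls of every radius, so
    radii may grow without bound.\<close>
  have cpt: "compact (closure (ball z r))" for z :: 'a and r
    using mms by (simp add: metric_measure_space_def bounded_closure)
  have int: "set_integrable M (ball z r) f" for z r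
    using locally_integrable_set_integrable[OF _ borel cpt closure_subset ball_sets] harm
    by (auto simp: strongly_harmonic_def)
  have intc: "set_integrable M (ball z r) (\<lambda>_. m)" if "r > 0" for z r
    using finite_ball[OF that] by (simp add: set_integrable_def less_top)
  have intd: "set_integrable M (ball z r) (\<lambda>w. f w - m)" if "r > 0" for z r
    using int intc[OF that] by (rule set_integral_diff)
  have mean: "(LINT w:ball z r|M. f w - m) = (f z - m) * measure M (ball z r)"
    if "r > 0" for z r
  proof -
    have "f z = (1 / measure M (ball z r)) * (LINT w:ball z r|M. f w)"
      using harm cpt that unfolding strongly_harmonic_def by blast
    then have "(LINT w:ball z r|M. f w) = f z * measure M (ball z r)"
      using pos[OF that, of z] by (simp add: field_simps)
    moreover have "(LINT w:ball z r|M. m) = m * measure M (ball z r)"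
      using finite_ball[OF that, of z] by (simp add: set_lebesgue_integral_def mult.commute)
    ultimately show ?thesis
      using set_integral_diff(2)[OF int intc[OF that], of z]
      by (simp add: left_diff_distrib)
  qed
  obtain C where C: "C > 0"
    "\<And>z r. r > 0 \<Longrightarrow> emeasure M (ball z (2 * r)) \<le> ennreal C * emeasure M (ball z r)"
    using dbl unfolding doubling_measure_def by blast
  \<comment> \<open>The radii advance in steps of \<open>2 * d\<close>, exactly the gap between the
    inner and outer balls around \<open>y\<close>; doubling the index doubles the radius.\<close>
  define a where "a n = measure M (ball y (real n * (2 * d)))" for n
  have a_pos: "a n > 0" if "n \<ge> 1" for n
    using that \<open>d > 0\<close> by (auto simp: a_def intro!: pos)
  have a_dbl: "a (2 * n) \<le> C * a n" if "n \<ge> 1" for n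
  proof -
    define r where "r = real n * (2 * d)"
    have "r > 0" using that \<open>d > 0\<close> by (simp add: r_def)
    have "measure M (ball y (2 * r)) \<le> enn2real (ennreal C * emeasure M (ball y r))"
      unfolding measure_def using C(2)[OF \<open>r > 0\<close>] finite_ball[OF \<open>r > 0\<close>, of y]
      by (intro enn2real_mono) (auto simp: ennreal_mult_less_top less_top)
    then show ?thesis
      using \<open>C > 0\<close> by (simp add: a_def r_def measure_def enn2real_mult mult.assoc)
  qed
  have bound: "f y - m \<le> (f x - m) * (1 + e)" if "e > 0" for e
  proof -
    obtain n where n: "n \<ge> 1" "a (Suc n) \<le> (1 + e) * a n"
      using doubling_sequence_ratio[of a, OF a_pos a_dbl C(1) \<open>e > 0\<close>] by blast
    define R where "R = real n * (2 * d)"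
    have "R > 0" using n \<open>d > 0\<close> by (simp add: R_def)
    \<comment> \<open>Each change of centre costs \<open>d\<close> in the radius, and
      \<open>R + 2 * d\<close> is the radius belonging to \<open>Suc n\<close>.\<close>
    have sub1: "ball y R \<subseteq> ball x (R + d)"
      unfolding d_def by metric
    have sub2: "ball x (R + d) \<subseteq> ball y (real (Suc n) * (2 * d))"
    proof
      fix w assume "w \<in> ball x (R + d)"
      then have "dist x w < R + d" by simp
      moreover have "dist y w \<le> d + dist x w"
        unfolding d_def using dist_triangle[of y w x] by (simp add: dist_commute)
      ultimately show "w \<in> ball y (real (Suc n) * (2 * d))"
        by (simp add: R_def algebra_simps)
    qed
    have "measure M (ball x (R + d)) \<le> a (Suc n)"
      unfolding a_def using finite_ball[of "real (Suc n) * (2 * d)" y] sub2 \<open>d > 0\<close>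
      by (intro measure_mono_fmeasurable fmeasurableI) (auto simp: less_top)
    have "(f y - m) * a n = (LINT w:ball y R|M. f w - m)"
      using mean[OF \<open>R > 0\<close>] by (simp add: a_def R_def)
    \<comment> \<open>Enlarging the domain cannot decrease the integral because \<open>f - m\<close>
      is nonnegative.\<close>
    also have "\<dots> \<le> (LINT w:ball x (R + d)|M. f w - m)"
      using intd[OF \<open>R > 0\<close>, of y] intd[of "R + d" x] \<open>R > 0\<close> \<open>d > 0\<close> sub1 m
      unfolding set_lebesgue_integral_def set_integrable_def
      by (intro integral_mono) (auto simp: indicator_def)
    also have "\<dots> = (f x - m) * measure M (ball x (R + d))"
      using mean[of "R + d" x] \<open>R > 0\<close> \<open>d > 0\<close> by simp
    also have "\<dots> \<le> (f x - m) * a (Suc n)"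
      using m[of x] \<open>measure M (ball x (R + d)) \<le> a (Suc n)\<close> by (intro mult_left_mono) auto
    also have "\<dots> \<le> (f x - m) * ((1 + e) * a n)"
      using n(2) m[of x] by (intro mult_left_mono) auto
    finally show ?thesis
      using a_pos[OF n(1)] by (simp add: mult.assoc[symmetric])
  qed
  show ?thesis
  proof (rule field_le_epsilon)
    fix e :: real assume "e > 0"
    define k where "k = f x - m"
    have "k \<ge> 0" using m[of x] by (simp add: k_def)
    \<comment> \<open>The error \<open>k * e / (k + 1)\<close> is at most \<open>e\<close>; the
      denominator \<open>k + 1\<close> stays positive even if \<open>k = 0\<close>.\<close>
    have "f y - m \<le> k * (1 + e / (k + 1))"
      unfolding k_def using \<open>e > 0\<close> \<open>k \<ge> 0\<close> by (intro bound) (simp add: k_def)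
    also have "\<dots> \<le> k + e"
      using \<open>k \<ge> 0\<close> \<open>e > 0\<close> by (simp add: field_simps)
    finally show "f y \<le> f x + e" by (simp add: k_def)
  qed
qed simp

theorem theorem7p3:
  fixes M :: "'a::metric_space measure" and f :: "'a \<Rightarrow> real"
  assumes "metric_measure_space M"
    and "geodesic_space TYPE('a)"
    and "doubling_measure M"
    and "strongly_harmonic M f"
    and "bdd_below (range f)"
  shows "f constant_on UNIV"
proof -
  obtain m where "\<And>z. m \<le> f z"
    using assms(5) by (auto simp: bdd_below_def)
  then have "f y \<le> f x" for x y
    using strongly_harmonic_le assms(1,3,4) by blast
  then show ?thesis
    unfolding constant_on_def by (meson order_antisym)
qed

end
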